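(* Let $a,b,a',b'\ge 1$ with $a+b=a'+b'$. Let $\rho$ and $\rho'$ be canonical sequential forms of non-crossing partitions of lengths $a$ and $a'$, respectively; if $b\ge 2$ assume that $\rho$ starts with a single $1$ (its initial run of $1$'s has length exactly one), and if $b'\ge 2$ assume that $\rho'$ starts with a single $1$. Let $\tau=(\rho+1)1^b$ and $\tau'=(\rho'+1)1^{b'}$. Then $\tau\equiv\tau'$ as subwords on $NC_n$; that is, for every $n\ge 0$ and every $k\ge 0$, the number of $\pi\in NC_n$ with $\mu_\tau(\pi)=k$ equals the number of $\pi\in NC_n$ with $\mu_{\tau'}(\pi)=k$.
   Context: A set partition of $[n]=\{1,\dots,n\}$ with blocks $B_1,\dots,B_k$ ordered so that $\min B_1<\cdots<\min B_k$ is represented by its canonical sequential form $\pi=\pi_1\cdots\pi_n$, where $i\in B_{\pi_i}$ for each $i$; $n$ is its length. It is non-crossing if $\pi$ contains no (not necessarily consecutive) subsequence of the form $a\,b\,a\,b$ with $a<b$. $NC_n$ denotes the set of non-crossing partitions of $[n]$, identified with their canonical sequential forms ($NC_0$ consists of the empty partition). A subword pattern is a finite sequence $\tau=\tau_1\cdots\tau_k$ of positive integers whose set of distinct letters is $[\ell]$ for some $\ell$. An occurrence of $\tau$ in a sequence $\sigma_1\cdots\sigma_n$ is an index $i\in[n-k+1]$ such that the string of consecutive letters $\sigma_i\cdots\sigma_{i+k-1}$ is order-isomorphic to $\tau$ (same relative order, including equalities). $\mu_\tau(\pi)$ denotes the number of occurrences of $\tau$ in $\pi$. $\rho+1$ is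 the sequence obtained by adding $1$ to each entry of $\rho$, $1^b$ is the word of $b$ ones, and juxtaposition is concatenation. *)

theory Defs
  imports "HOL-Library.Disjoint_Sets" "HOL-Library.Sublist"
begin

text \<open>Words are 0-indexed lists, so entry \<open>w ! i\<close> describes the element \<open>i + 1\<close>, and the block
  \<open>B\<^sub>j\<close> is \<open>Bs ! (j - 1)\<close>.\<close>

definition canonical_form :: "nat \<Rightarrow> nat set set \<Rightarrow> nat list \<Rightarrow> bool" where
  "canonical_form n P w \<longleftrightarrow>
     (\<exists>Bs. set Bs = P \<and> sorted_wrt (\<lambda>B C. Min B < Min C) Bs \<and> length w = n \<and>
        (\<forall>i<n. 1 \<le> w ! i \<and> w ! i \<le> length Bs \<and> Suc i \<in> Bs ! (w ! i - 1)))"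

definition noncrossing :: "nat list \<Rightarrow> bool" where
  "noncrossing w \<longleftrightarrow> \<not> (\<exists>a b. a < b \<and> subseq [a, b, a, b] w)"

definition NC :: "nat \<Rightarrow> nat list set" where
  "NC n = {w. \<exists>P. partition_on {1..n} P \<and> canonical_form n P w \<and> noncrossing w}"

definition order_isomorphic :: "nat list \<Rightarrow> nat list \<Rightarrow> bool" where
  "order_isomorphic u v \<longleftrightarrow> length u = length v \<and>
     (\<forall>i<length u. \<forall>j<length u. (u ! i < u ! j \<longleftrightarrow> v ! i < v ! j) \<and> (u ! i = u ! j \<longleftrightarrow> v ! i = v ! j))"

definition occurrences :: "nat list \<Rightarrow> nat list \<Rightarrow> nat" where
  "occurrences \<tau> w =
     card {i. i + length \<tau> \<le> length w \<and> order_isomorphic (take (length \<tau>) (drop i w)) \<tau>}"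

definition subword_equiv :: "nat list \<Rightarrow> nat list \<Rightarrow> bool" where
  "subword_equiv \<tau> \<tau>' \<longleftrightarrow>
     (\<forall>n k. card {w \<in> NC n. occurrences \<tau> w = k} = card {w \<in> NC n. occurrences \<tau>' w = k})"

definition starts_with_single_one :: "nat list \<Rightarrow> bool" where
  "starts_with_single_one w \<longleftrightarrow> length (takeWhile (\<lambda>x. x = 1) w) = 1"

text \<open>The cardinalities in \<open>subword_equiv\<close> are those of finite sets.\<close>

lemma finite_NC: "finite (NC n)"
proof -
  let ?L = "{w :: nat list. set w \<subseteq> {..2 ^ n} \<and> length w = n}"
  have "w \<in> ?L" if w: "w \<in> NC n" for w
  proof -
    obtain P Bs where P: "partition_on {1..n} P" and Bs: "set Bs = P"
      "sorted_wrt (\<lambda>B C. Min B < Min C) Bs" "length w = n" "\<forall>i<n. w ! i \<le> length Bs"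
      using w unfolding NC_def canonical_form_def by blast
    have "distinct Bs"
      using Bs(2) by (induction Bs) auto
    then have "length Bs = card P"
      using Bs(1) distinct_card by metis
    also have "\<dots> \<le> card (Pow {1..n})"
      using P by (intro card_mono) (auto simp: partition_on_def)
    finally have "length Bs \<le> 2 ^ n"
      by (simp add: card_Pow)
    then show ?thesis
      using Bs(3,4) by (fastforce simp: in_set_conv_nth)
  qed
  then show ?thesis
    using finite_lists_length_eq[of "{..2 ^ n :: nat}" n] by (meson finite_atMost finite_subset subsetI)
qed

end

(* Write F_n = sum over w in NC_n of q^(mu w). A nonempty w factors uniquely as 1 (u + 1) v', where v'
   is empty or continues the first block and becomes a noncrossing v after closing the gap in its
   letters. As 1 is the smallest letter of the pattern, mu w = mu u + mu v, plus 1 exactly when u has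
   a suffix isomorphic to rho and v starts with 1^b. A word u with such a suffix is determined by the
   prefix ending in the first letter of that suffix: all other letters of the suffix are either equal
   to that letter or new. Since rho starts with a single 1 (or b = 1), this truncation preserves mu;
   likewise for deleting b - 1 leading ones from v. Hence
     F_(n+1) = sum_(i+j=n) F_i F_j + (q - 1) sum_(i+j=n+2-(a+b); i,j>=1) F_i F_j,
   a recursion which only depends on a + b. *)

theory Submission
  imports Defs "HOL-Computational_Algebra.Polynomial"
begin

section \<open>Canonical sequential forms as restricted growth words\<close>

text \<open>Restricted growth of a word continuing a prefix with letter set \<open>{1..k}\<close>; the new letter set
  is then \<open>{1..fold max w k}\<close>.\<close>

primrec rgf_from :: "nat \<Rightarrow> nat list \<Rightarrow> bool" where
  "rgf_from k [] \<longleftrightarrow> True"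
| "rgf_from k (c # w) \<longleftrightarrow> 0 < c \<and> c \<le> Suc k \<and> rgf_from (max k c) w"

lemma rgf_from_append:
  "rgf_from k (u @ v) \<longleftrightarrow> rgf_from k u \<and> rgf_from (fold max u k) v"
  by (induction u arbitrary: k) (auto simp: max.commute)

lemma rgf_from_set:
  "rgf_from k u \<Longrightarrow> {1..k} \<union> set u = {1..fold max u k}"
proof (induction u arbitrary: k)
  case (Cons c u)
  have "{1..k} \<union> set (c # u) = {1..max k c} \<union> set u"
    using Cons.prems by (auto simp: max_def le_Suc_eq)
  then show ?case
    using Cons by (simp add: max.commute)
qed simp

lemma rgf_from_pos: "rgf_from k u \<Longrightarrow> x \<in> set u \<Longrightarrow> 0 < x"
  by (induction u arbitrary: k) auto

text \<open>A closed form of the recursive predicate that looks at one entry and its predecessors,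
  as needed for comparing block minima and for producing crossings. Induction runs from the right
  because appending a letter leaves the earlier conditions untouched.\<close>

lemma rgf_from_nth_iff:
  "rgf_from k w \<longleftrightarrow> (\<forall>i<length w. 0 < w ! i \<and> {1..<w ! i} \<subseteq> {1..k} \<union> set (take i w))"
proof (induction w rule: rev_induct)
  case (snoc c w)
  have "(\<forall>i<length (w @ [c]). 0 < (w @ [c]) ! i \<and> {1..<(w @ [c]) ! i} \<subseteq> {1..k} \<union> set (take i (w @ [c])))
     \<longleftrightarrow> rgf_from k w \<and> 0 < c \<and> {1..<c} \<subseteq> {1..k} \<union> set w"
    unfolding snoc by (auto simp: less_Suc_eq nth_append)
  also have "\<dots> \<longleftrightarrow> rgf_from k w \<and> 0 < c \<and> {1..<c} \<subseteq> {1..fold max w k}"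
    using rgf_from_set by auto
  also have "\<dots> \<longleftrightarrow> rgf_from k w \<and> 0 < c \<and> c \<le> Suc (fold max w k)"
  proof -
    have "{1..<c} \<subseteq> {1..fold max w k} \<longleftrightarrow> c \<le> Suc (fold max w k)" if "0 < c"
    proof
      assume A: "{1..<c} \<subseteq> {1..fold max w k}"
      show "c \<le> Suc (fold max w k)"
      proof (cases "c = 1")
        case False
        with that have "c - 1 \<in> {1..<c}" by auto
        with A have "c - 1 \<in> {1..fold max w k}" by blast
        then show ?thesis by auto
      qed auto
    qed auto
    then show ?thesis by auto
  qed
  also have "\<dots> \<longleftrightarrow> rgf_from k (w @ [c])"
    by (simp add: rgf_from_append)
  finally show ?case by blast
qed simp

text \<open>If \<open>c\<close> is smaller than the letter at \<open>i\<close>, block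
  \<open>c\<close> has the smaller minimum, and this minimum is an earlier element carrying the
  letter \<open>c\<close>.\<close>

lemma canonical_form_imp_rgf:
  assumes P: "partition_on {1..n} P" and w: "canonical_form n P w"
  shows "rgf_from 0 w"
proof -
  obtain Bs where Bs: "set Bs = P" "sorted_wrt (\<lambda>B C. Min B < Min C) Bs" "length w = n"
    and mem: "\<And>i. i < n \<Longrightarrow> 1 \<le> w ! i \<and> w ! i \<le> length Bs \<and> Suc i \<in> Bs ! (w ! i - 1)"
    using w unfolding canonical_form_def by blast
  have block: "B \<noteq> {}" "finite B" "B \<subseteq> {1..n}" if "B \<in> set Bs" for B
  proof -
    show "B \<noteq> {}" "B \<subseteq> {1..n}"
      using that P Bs(1) by (auto simp: partition_on_def)
    then show "finite B" using finite_subset by blast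
  qed
  have uniq: "s = t" if "s < length Bs" "t < length Bs" "x \<in> Bs ! s" "x \<in> Bs ! t" for s t x
  proof -
    have "disjoint (set Bs)" using P Bs(1) by (simp add: partition_on_def)
    then have "Bs ! s = Bs ! t"
      using that nth_mem[of s Bs] nth_mem[of t Bs] by (meson disjointD disjoint_iff)
    moreover have "distinct Bs"
      using Bs(2) by (induction Bs) auto
    ultimately show ?thesis using that nth_eq_iff_index_eq by blast
  qed
  have "c \<in> set (take i w)" if i: "i < n" and c: "1 \<le> c" "c < w ! i" for i c
  proof -
    have cl: "c - 1 < length Bs" "w ! i - 1 < length Bs" "c - 1 < w ! i - 1"
      using mem[OF i] c by auto
    define p where "p = Min (Bs ! (c - 1))"
    have p: "p \<in> Bs ! (c - 1)" "p \<in> {1..n}"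
      using block[OF nth_mem[OF cl(1)]] Min_in unfolding p_def by blast+
    have "p < Min (Bs ! (w ! i - 1))"
      using Bs(2) cl unfolding p_def by (metis sorted_wrt_nth_less)
    also have "\<dots> \<le> Suc i"
      using mem[OF i] block(2)[OF nth_mem[OF cl(2)]] by simp
    finally have "p - 1 < i" using p by auto
    have "p - 1 < n" "Suc (p - 1) = p" using p by auto
    with mem[of "p - 1"] have wp: "1 \<le> w ! (p - 1)" "w ! (p - 1) - 1 < length Bs"
      "p \<in> Bs ! (w ! (p - 1) - 1)"
      by auto
    have "w ! (p - 1) - 1 = c - 1"
      by (rule uniq[OF wp(2) cl(1) wp(3) p(1)])
    then have "w ! (p - 1) = c"
      using wp c by auto
    then show ?thesis
      using \<open>p - 1 < i\<close> i Bs(3) by (auto simp: in_set_conv_nth)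
  qed
  moreover have "0 < w ! i" if "i < n" for i
    using mem[OF that] by simp
  ultimately show ?thesis
    unfolding rgf_from_nth_iff using Bs(3) by auto
qed

text \<open>The blocks are the level sets \<open>B c\<close>, listed by letter. Restricted growth
  makes the first occurrences of the letters increase, which is the required order of the
  minima.\<close>

lemma rgf_imp_canonical_form:
  assumes w: "rgf_from 0 w"
  shows "\<exists>P. partition_on {1..length w} P \<and> canonical_form (length w) P w"
proof -
  define M where "M = fold max w 0"
  define B where "B c = {Suc i |i. i < length w \<and> w ! i = c}" for c
  have setw: "set w = {1..M}"
    using rgf_from_set[OF w] by (simp add: M_def)
  have ne: "B c \<noteq> {}" if "c \<in> {1..M}" for c
  proof -
    have "c \<in> set w" using that setw by simp
    then show ?thesis by (auto simp: B_def in_set_conv_nth)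
  qed
  have fin: "finite (B c)" for c by (simp add: B_def)
  define Bs where "Bs = map B [1..<Suc M]"
  have MB: "w ! i \<in> {1..M}" if "i < length w" for i
    using that setw nth_mem by metis
  have Min_less: "Min (B c) < Min (B d)" if cd: "c < d" "1 \<le> c" "d \<le> M" for c d
  proof -
    have "Min (B d) \<in> B d" using ne[of d] fin cd by simp
    then obtain j where j: "j < length w" "w ! j = d" "Min (B d) = Suc j"
      by (auto simp: B_def)
    have "c \<in> set (take j w)"
      using w j cd unfolding rgf_from_nth_iff by (fastforce dest: spec[of _ j])
    then obtain i where i: "i < j" "w ! i = c"
      using j by (auto simp: in_set_conv_nth)
    then have "Suc i \<in> B c" using j by (auto simp: B_def)
    then have "Min (B c) \<le> Suc i" using fin by simp
    then show ?thesis using i j by simp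
  qed
  have "partition_on {1..length w} (set Bs)"
  proof (rule partition_onI)
    have "\<Union> (set Bs) = Suc ` {..<length w}"
      using MB by (force simp: Bs_def B_def)
    then show "\<Union> (set Bs) = {1..length w}"
      by (simp add: image_Suc_lessThan)
    show "{} \<notin> set Bs"
    proof
      assume "{} \<in> set Bs"
      then obtain c where "c \<in> set [1..<Suc M]" "B c = {}"
        unfolding Bs_def set_map by blast
      then show False using ne[of c] by auto
    qed
  qed (auto simp: Bs_def B_def disjnt_def)
  moreover have "canonical_form (length w) (set Bs) w"
    unfolding canonical_form_def
  proof (intro exI[of _ Bs] conjI refl allI impI)
    show "sorted_wrt (\<lambda>B C. Min B < Min C) Bs"
      unfolding sorted_wrt_iff_nth_less using Min_less by (auto simp: Bs_def simp del: upt_Suc)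
  next
    fix i assume i: "i < length w"
    show "1 \<le> w ! i" "w ! i \<le> length Bs"
      using MB[OF i] by (auto simp: Bs_def)
    then show "Suc i \<in> Bs ! (w ! i - 1)"
      using i by (auto simp: Bs_def B_def simp del: upt_Suc)
  qed
  ultimately show ?thesis by blast
qed

text \<open>Replaces set partitions by conditions on the word alone.\<close>

lemma NC_iff: "w \<in> NC n \<longleftrightarrow> length w = n \<and> rgf_from 0 w \<and> noncrossing w"
proof
  assume "w \<in> NC n"
  then show "length w = n \<and> rgf_from 0 w \<and> noncrossing w"
    using canonical_form_imp_rgf by (auto simp: NC_def canonical_form_def)
next
  assume "length w = n \<and> rgf_from 0 w \<and> noncrossing w"
  then show "w \<in> NC n"
    using rgf_imp_canonical_form[of w] by (auto simp: NC_def)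
qed

section \<open>Order isomorphism and monotone relabelling\<close>

lemma order_isomorphic_iff_map:
  "order_isomorphic y r \<longleftrightarrow> (\<exists>h. strict_mono_on (set r) h \<and> y = map h r)"
proof
  assume iso: "order_isomorphic y r"
  \<comment> \<open>For a letter \<open>c\<close> of \<open>r\<close> any of its positions would do:
    equal letters of \<open>r\<close> face equal letters of \<open>y\<close>.\<close>
  define h where "h c = y ! (SOME i. i < length r \<and> r ! i = c)" for c
  have h: "h (r ! i) = y ! i" if "i < length r" for i
  proof -
    define j where "j = (SOME j. j < length r \<and> r ! j = r ! i)"
    have "j < length r \<and> r ! j = r ! i"
      unfolding j_def by (rule someI[of _ i]) (use that in auto)
    then show ?thesis
      using iso that by (auto simp: order_isomorphic_def h_def simp flip: j_def)
  qed
  have "strict_mono_on (set r) h"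
    using iso h by (auto simp: strict_mono_on_def in_set_conv_nth order_isomorphic_def)
  moreover have "y = map h r"
    using iso h by (auto simp: order_isomorphic_def intro: nth_equalityI)
  ultimately show "\<exists>h. strict_mono_on (set r) h \<and> y = map h r" by blast
next
  assume "\<exists>h. strict_mono_on (set r) h \<and> y = map h r"
  then obtain h where h: "strict_mono_on (set r) h" "y = map h r" by blast
  then show "order_isomorphic y r"
    by (auto simp: order_isomorphic_def strict_mono_on_less strict_mono_on_eq)
qed

lemma order_isomorphic_map:
  assumes "strict_mono_on (set y) f"
  shows "order_isomorphic (map f y) r \<longleftrightarrow> order_isomorphic y r"
  using assms
  by (auto simp: order_isomorphic_def strict_mono_on_less strict_mono_on_eq)

lemma subseq_imp_subset: "subseq u w \<Longrightarrow> set u \<subseteq> set w"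
  by (auto simp: subseq_conv_nths dest: in_set_nthsD)

lemma noncrossing_map:
  assumes f: "strict_mono_on (set w) f"
  shows "noncrossing (map f w) \<longleftrightarrow> noncrossing w"
proof
  assume N: "noncrossing (map f w)"
  show "noncrossing w"
    unfolding noncrossing_def
  proof clarify
    fix a b :: nat assume "a < b" "subseq [a, b, a, b] w"
    then have "{a, b} \<subseteq> set w" "subseq [f a, f b, f a, f b] (map f w)"
      using subseq_map[of "[a, b, a, b]" w f] by (auto dest: subseq_imp_subset)
    with f \<open>a < b\<close> N show False
      by (auto simp: noncrossing_def strict_mono_on_def)
  qed
next
  assume N: "noncrossing w"
  show "noncrossing (map f w)"
    unfolding noncrossing_def
  proof clarify
    fix a b assume ab: "a < b" "subseq [a, b, a, b] (map f w)"
    \<comment> \<open>The pattern lifts to four letters of \<open>w\<close> that are not yet known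
      to repeat; injectivity of \<open>f\<close> on \<open>set w\<close> identifies the first with
      the third and the second with the fourth.\<close>
    then obtain I where "[a, b, a, b] = map f (nths w I)"
      by (metis subseq_conv_nths nths_map)
    then obtain p q r s where pq: "nths w I = [p, q, r, s]" "f p = a" "f q = b" "f r = a" "f s = b"
      by (auto simp: map_eq_Cons_conv Cons_eq_map_conv)
    then have sub: "subseq [p, q, r, s] w" by (metis subseq_conv_nths)
    then have "{p, q, r, s} \<subseteq> set w" by (auto dest: subseq_imp_subset)
    with pq f ab have "p = r" "q = s" "p < q"
      by (auto simp: strict_mono_on_eq strict_mono_on_less)
    with sub N show False by (auto simp: noncrossing_def)
  qed
qed

section \<open>Pattern occurrences in a concatenation\<close>

definition pattern :: "nat list \<Rightarrow> nat \<Rightarrow> nat list" where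
  "pattern r b = map (\<lambda>x. x + 1) r @ replicate b 1"

definition iso_prefix :: "nat list \<Rightarrow> nat list \<Rightarrow> bool" where
  "iso_prefix \<tau> w \<longleftrightarrow> length \<tau> \<le> length w \<and> order_isomorphic (take (length \<tau>) w) \<tau>"

text \<open>Together with \<open>ones_prefix\<close> this describes an occurrence across a seam: the
  copy of \<open>r\<close> ends the left word and the run of ones starts the right one.\<close>

definition iso_suffix :: "nat list \<Rightarrow> nat list \<Rightarrow> bool" where
  "iso_suffix r u \<longleftrightarrow> (\<exists>s y. u = s @ y \<and> order_isomorphic y r)"

definition ones_prefix :: "nat \<Rightarrow> nat list \<Rightarrow> bool" where
  "ones_prefix b v \<longleftrightarrow> (\<exists>t. v = replicate b 1 @ t)"

lemma length_pattern [simp]: "length (pattern r b) = length r + b"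
  by (simp add: pattern_def)

lemma order_isomorphic_length: "order_isomorphic y r \<Longrightarrow> length y = length r"
  by (simp add: order_isomorphic_def)

text \<open>The final letters are all images of the smallest letter \<open>1\<close>, so order
  isomorphism only asks for a common value \<open>m\<close> below a copy of \<open>r\<close>.
  Positivity of \<open>r\<close> keeps its shifted letters apart from that \<open>1\<close>.\<close>

lemma order_isomorphic_pattern:
  assumes r: "\<forall>x\<in>set r. 0 < x" and b: "0 < b"
  shows "order_isomorphic z (pattern r b) \<longleftrightarrow>
    (\<exists>y m. z = y @ replicate b m \<and> order_isomorphic y r \<and> (\<forall>x\<in>set y. m < x))"
proof
  assume "order_isomorphic z (pattern r b)"
  then obtain h where h: "strict_mono_on (set (pattern r b)) h" "z = map h (pattern r b)"
    by (auto simp: order_isomorphic_iff_map)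
  have "strict_mono_on (set r) (\<lambda>x. h (x + 1))"
    using h(1) by (auto simp: strict_mono_on_def pattern_def)
  moreover have "h 1 < h (x + 1)" if "x \<in> set r" for x
    using h(1) that r b by (auto simp: strict_mono_on_def pattern_def)
  moreover have "z = map (\<lambda>x. h (x + 1)) r @ replicate b (h 1)"
    using h(2) by (simp add: pattern_def)
  ultimately show "\<exists>y m. z = y @ replicate b m \<and> order_isomorphic y r \<and> (\<forall>x\<in>set y. m < x)"
    by (intro exI[of _ "map (\<lambda>x. h (x + 1)) r"] exI[of _ "h 1"])
       (auto simp: order_isomorphic_iff_map)
next
  assume "\<exists>y m. z = y @ replicate b m \<and> order_isomorphic y r \<and> (\<forall>x\<in>set y. m < x)"
  then obtain y m where y: "z = y @ replicate b m" "order_isomorphic y r" "\<forall>x\<in>set y. m < x"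
    by blast
  then obtain h where "strict_mono_on (set r) h" "y = map h r"
    by (auto simp: order_isomorphic_iff_map)
  with y have h: "z = map h r @ replicate b m" "strict_mono_on (set r) h" "\<forall>x\<in>set r. m < h x"
    by auto
  \<comment> \<open>\<open>h'\<close> sends the letter \<open>1\<close> to \<open>m\<close> and
    undoes the shift by one elsewhere.\<close>
  define h' where "h' c = (if c = 1 then m else h (c - 1))" for c
  have "strict_mono_on (set (pattern r b)) h'"
    using h r by (auto simp: strict_mono_on_def pattern_def h'_def)
  moreover have "z = map h' (pattern r b)"
    using h(1) r by (auto simp: pattern_def h'_def)
  ultimately show "order_isomorphic z (pattern r b)"
    by (auto simp: order_isomorphic_iff_map)
qed

lemma iso_prefix_pattern:
  assumes "\<forall>x\<in>set r. 0 < x" "0 < b"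
  shows "iso_prefix (pattern r b) w \<longleftrightarrow>
    (\<exists>y m t. w = y @ replicate b m @ t \<and> order_isomorphic y r \<and> (\<forall>x\<in>set y. m < x))"
proof
  assume "iso_prefix (pattern r b) w"
  then obtain y m where "take (length r + b) w = y @ replicate b m" "order_isomorphic y r"
    "\<forall>x\<in>set y. m < x"
    by (auto simp: iso_prefix_def order_isomorphic_pattern[OF assms])
  then show "\<exists>y m t. w = y @ replicate b m @ t \<and> order_isomorphic y r \<and> (\<forall>x\<in>set y. m < x)"
    by (metis append_take_drop_id append.assoc)
next
  assume "\<exists>y m t. w = y @ replicate b m @ t \<and> order_isomorphic y r \<and> (\<forall>x\<in>set y. m < x)"
  then obtain y m t where y: "w = y @ replicate b m @ t" "order_isomorphic y r" "\<forall>x\<in>set y. m < x"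
    by blast
  then have "order_isomorphic (y @ replicate b m) (pattern r b)"
    using order_isomorphic_pattern[OF assms] by blast
  then show "iso_prefix (pattern r b) w"
    using y(1) order_isomorphic_length[OF y(2)] by (simp add: iso_prefix_def)
qed

lemma occurrences_Nil: "\<tau> \<noteq> [] \<Longrightarrow> occurrences \<tau> [] = 0"
  by (simp add: occurrences_def)

lemma occurrences_Cons:
  assumes "\<tau> \<noteq> []"
  shows "occurrences \<tau> (x # w) = of_bool (iso_prefix \<tau> (x # w)) + occurrences \<tau> w"
proof -
  define S where "S w = {i. i + length \<tau> \<le> length w \<and> order_isomorphic (take (length \<tau>) (drop i w)) \<tau>}" for w
  have "S (x # w) = (if iso_prefix \<tau> (x # w) then {0} else {}) \<union> Suc ` S w"
  proof (rule set_eqI)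
    fix i
    show "i \<in> S (x # w) \<longleftrightarrow> i \<in> (if iso_prefix \<tau> (x # w) then {0} else {}) \<union> Suc ` S w"
      by (cases i) (auto simp: S_def iso_prefix_def)
  qed
  moreover have "finite (S w)"
    by (rule finite_subset[of _ "{..length w}"]) (auto simp: S_def)
  ultimately show ?thesis
    unfolding occurrences_def S_def[symmetric] by (auto simp: card_image)
qed

lemma occurrences_map:
  assumes "strict_mono_on (set w) f"
  shows "occurrences \<tau> (map f w) = occurrences \<tau> w"
proof -
  have "order_isomorphic (map f (take l (drop i w))) \<tau> \<longleftrightarrow> order_isomorphic (take l (drop i w)) \<tau>" for l i
    using assms
    by (intro order_isomorphic_map) (auto simp: strict_mono_on_def dest!: in_set_takeD in_set_dropD)
  then show ?thesis
    by (simp add: occurrences_def drop_map take_map)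
qed

lemma iso_suffix_Cons:
  "iso_suffix r (x # u) \<longleftrightarrow> iso_suffix r u \<or> order_isomorphic (x # u) r"
  by (auto simp: iso_suffix_def Cons_eq_append_conv)

text \<open>The window is longer than \<open>u\<close>, so it contains the leading \<open>1\<close>
  of \<open>v\<close>. No positive letter lies below \<open>1\<close>, so this \<open>1\<close>
  belongs to the final run, and the run cannot begin inside \<open>u\<close>, whose letters exceed
  \<open>1\<close>. Hence the two parts of the pattern meet exactly at the seam.\<close>

lemma iso_prefix_overlap:
  assumes r: "\<forall>x\<in>set r. 0 < x" and b: "0 < b"
    and u: "\<forall>x\<in>set u. 1 < x" and v: "v = [] \<or> hd v = 1" "\<forall>x\<in>set v. 0 < x"
    and long: "length u < length r + b"
  shows "iso_prefix (pattern r b) (u @ v) \<longleftrightarrow> order_isomorphic u r \<and> ones_prefix b v"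
proof
  assume "iso_prefix (pattern r b) (u @ v)"
  then obtain y m t where y: "u @ v = y @ replicate b m @ t" "order_isomorphic y r" "\<forall>x\<in>set y. m < x"
    using iso_prefix_pattern[OF r b] by blast
  have ly: "length y = length r" using y(2) order_isomorphic_length by blast
  have len: "length (u @ v) = length r + b + length t" using y(1) ly by simp
  with long have "v \<noteq> []" by auto
  with v have v1: "(u @ v) ! length u = 1" by (simp add: nth_append hd_conv_nth)
  have "m \<in> set (u @ v)" using y(1) b by simp
  then have "0 < m" using u v by auto
  have "length y \<le> length u"
  proof (rule ccontr)
    assume A: "\<not> length y \<le> length u"
    then have "(u @ v) ! length u \<in> set y" unfolding y(1) by (simp add: nth_append)
    then show False using v1 y(3) \<open>0 < m\<close> by auto
  qed
  then have "length u - length y < b" using long ly by simp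
  then have m: "m = 1"
    using v1 \<open>length y \<le> length u\<close> unfolding y(1) by (simp add: nth_append)
  have "length y = length u"
  proof (rule ccontr)
    assume "length y \<noteq> length u"
    with \<open>length y \<le> length u\<close> have "length y < length u" by simp
    then have "(u @ v) ! length y \<in> set u" by (simp add: nth_append)
    moreover have "(u @ v) ! length y = m" unfolding y(1) using b by (simp add: nth_append)
    ultimately show False using u m by auto
  qed
  then have "u = y" "v = replicate b m @ t" using y(1) by auto
  then show "order_isomorphic u r \<and> ones_prefix b v"
    using y(2) m by (auto simp: ones_prefix_def)
next
  assume "order_isomorphic u r \<and> ones_prefix b v"
  then show "iso_prefix (pattern r b) (u @ v)"
    using iso_prefix_pattern[OF r b] u by (auto simp: ones_prefix_def)
qed

text \<open>A start in \<open>u\<close> either has its whole window inside \<open>u\<close> or falls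
  under \<open>iso_prefix_overlap\<close>; the starts in \<open>v\<close> give the second
  summand.\<close>

lemma occurrences_pattern_append:
  assumes r: "\<forall>x\<in>set r. 0 < x" "r \<noteq> []" and b: "0 < b"
    and u: "\<forall>x\<in>set u. 1 < x" and v: "v = [] \<or> hd v = 1" "\<forall>x\<in>set v. 0 < x"
  shows "occurrences (pattern r b) (u @ v) = occurrences (pattern r b) u + occurrences (pattern r b) v
     + of_bool (iso_suffix r u \<and> ones_prefix b v)"
  using u
proof (induction u)
  case Nil
  then show ?case
    using r b occurrences_Nil[of "pattern r b"] by (auto simp: iso_suffix_def pattern_def order_isomorphic_def)
next
  case (Cons x u)
  let ?p = "pattern r b"
  have ne: "?p \<noteq> []" using r by (simp add: pattern_def)
  have IH: "occurrences ?p (u @ v) = occurrences ?p u + occurrences ?p v + of_bool (iso_suffix r u \<and> ones_prefix b v)"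
    using Cons by simp
  show ?case
  proof (cases "length r + b \<le> length (x # u)")
    case True
    then have "iso_prefix ?p (x # u @ v) = iso_prefix ?p (x # u)"
      using take_append[of "length r + b" "x # u" v] by (simp add: iso_prefix_def)
    moreover have "iso_suffix r (x # u) = iso_suffix r u"
      using True b by (auto simp: iso_suffix_Cons dest: order_isomorphic_length)
    ultimately show ?thesis
      by (simp add: occurrences_Cons[OF ne] IH)
  next
    case False
    then have "iso_prefix ?p (x # u @ v) \<longleftrightarrow> order_isomorphic (x # u) r \<and> ones_prefix b v"
      using iso_prefix_overlap[OF r(1) b Cons.prems v] by simp
    moreover have "\<not> iso_prefix ?p (x # u)"
      using False by (simp add: iso_prefix_def)
    \<comment> \<open>Both suffixes would have length \<open>length r\<close>, so the seam is
      counted at most once.\<close>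
    moreover have "\<not> (iso_suffix r u \<and> order_isomorphic (x # u) r)"
      by (auto simp: iso_suffix_def dest!: order_isomorphic_length)
    ultimately show ?thesis
      by (auto simp: occurrences_Cons[OF ne] IH iso_suffix_Cons)
  qed
qed

text \<open>As \<open>r\<close> is nonempty, an occurrence starting here would have its first letter
  strictly above its last, which leaves no positive value for the latter.\<close>

lemma occurrences_pattern_one_Cons:
  assumes r: "\<forall>x\<in>set r. 0 < x" "r \<noteq> []" and b: "0 < b" and v: "\<forall>x\<in>set v. 0 < x"
  shows "occurrences (pattern r b) (1 # v) = occurrences (pattern r b) v"
proof -
  have "\<not> iso_prefix (pattern r b) (1 # v)"
  proof
    assume "iso_prefix (pattern r b) (1 # v)"
    then obtain y m t where y: "1 # v = y @ replicate b m @ t" "order_isomorphic y r" "\<forall>x\<in>set y. m < x"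
      using iso_prefix_pattern[OF r(1) b] by blast
    then have "y \<noteq> []" using r by (auto simp: order_isomorphic_def)
    with y have "m < 1" by (cases y) auto
    moreover have "m \<in> set (1 # v)" unfolding y(1) using b by simp
    ultimately show False using v by auto
  qed
  moreover have "pattern r b \<noteq> []" using r by (simp add: pattern_def)
  ultimately show ?thesis by (simp add: occurrences_Cons)
qed

section \<open>Factoring a noncrossing word at its first block\<close>

text \<open>Relabels a word that continues one with letters \<open>{1..K + 1}\<close>: its first
  block is merged into block \<open>m\<close>, and its letters from \<open>2\<close> on become the
  new letters from \<open>K + 2\<close> on. Gluing takes \<open>m = 1\<close>; the extension of a
  suffix takes the last letter of the prefix.\<close>

definition shift_letter :: "nat \<Rightarrow> nat \<Rightarrow> nat \<Rightarrow> nat" where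
  "shift_letter m K c = (if c = 1 then m else c + K)"

lemma strict_mono_on_shift_letter:
  assumes "m \<le> Suc K" "0 \<notin> A"
  shows "strict_mono_on A (shift_letter m K)"
  unfolding strict_mono_on_def shift_letter_def
proof (intro allI impI)
  fix r s assume *: "r \<in> A \<and> s \<in> A \<and> r < s"
  then have "r > 0" "s > 0" using assms by (auto intro!: Nat.gr0I)
  then show "(if r = 1 then m else r + K) < (if s = 1 then m else s + K)"
    using * assms by auto
qed

text \<open>A maximum \<open>j\<close> before relabelling corresponds to \<open>j + K\<close> after
  it. The condition \<open>0 < j\<close> says that \<open>1\<close> has been seen, so that its image
  \<open>m\<close> is an old letter too.\<close>

lemma rgf_from_shift_letter:
  assumes "0 < m" "m \<le> Suc K" "0 < j" "0 \<notin> set v"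
  shows "rgf_from (j + K) (map (shift_letter m K) v) \<longleftrightarrow> rgf_from j v"
  using assms(3,4)
proof (induction v arbitrary: j)
  case (Cons c v)
  have "max (j + K) (shift_letter m K c) = max j c + K"
    using Cons.prems assms by (auto simp: shift_letter_def)
  then show ?case
    using Cons assms by (auto simp: shift_letter_def)
qed simp

lemma fold_max_map_Suc: "fold max (map Suc u) (Suc k) = Suc (fold max u k)"
  by (induction u arbitrary: k) (auto simp: max_def)

lemma rgf_from_map_Suc:
  assumes "0 \<notin> set u"
  shows "rgf_from (Suc k) (map Suc u) \<longleftrightarrow> rgf_from k u"
  using assms by (induction u arbitrary: k) auto

lemma rgf_from_0_iff: "rgf_from 0 v \<longleftrightarrow> (v = [] \<or> hd v = 1) \<and> rgf_from 1 v"
  by (cases v) (auto simp: le_Suc_eq)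

lemma noncrossing_subseq: "noncrossing w \<Longrightarrow> subseq u w \<Longrightarrow> noncrossing u"
  unfolding noncrossing_def using subseq_order.order_trans by blast

text \<open>\<open>y\<close> can only come from \<open>q\<close>, so the last \<open>x\<close> would
  come from \<open>q\<close> as well, where it does not occur.\<close>

lemma not_subseq_interleaved:
  assumes "x \<in> set p" "y \<notin> set p" "set p \<inter> set q = {}"
  shows "\<not> subseq [x, y, x] (p @ q)"
proof
  assume "subseq [x, y, x] (p @ q)"
  then obtain us vs where "[x, y, x] = us @ vs" "subseq us p" "subseq vs q"
    by (rule subseq_appendE)
  moreover from this have "set us \<subseteq> set p" "set vs \<subseteq> set q"
    by (auto dest: subseq_imp_subset)
  ultimately show False
    using assms by (auto simp: Cons_eq_append_conv)
qed

text \<open>Since \<open>p\<close> is one contiguous stretch with letters of its own, none of them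
  can interleave with a letter outside \<open>p\<close>; a crossing thus lives entirely in
  \<open>p\<close> or in \<open>1 # q\<close>.\<close>

lemma noncrossing_first_block:
  assumes p: "1 \<notin> set p" and q: "q = [] \<or> hd q = 1" and disj: "set p \<inter> set q = {}"
  shows "noncrossing (1 # p @ q) \<longleftrightarrow> noncrossing p \<and> noncrossing q"
proof
  assume "noncrossing (1 # p @ q)"
  moreover have "subseq p (1 # p @ q)" "subseq q (1 # p @ q)"
    by (auto intro: subseq_Cons' list_emb_append2 subseq_rev_drop_many)
  ultimately show "noncrossing p \<and> noncrossing q"
    using noncrossing_subseq by blast
next
  assume N: "noncrossing p \<and> noncrossing q"
  show "noncrossing (1 # p @ q)"
    unfolding noncrossing_def
  proof clarify
    fix a b assume ab: "a < b" and sub: "subseq [a, b, a, b] (1 # p @ q)"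
    have bab: "subseq [b, a, b] (p @ q)"
      using sub by (auto split: if_splits dest: subseq_Cons')
    have aba: "subseq [a, b, a] (p @ q)" if "a \<noteq> 1"
      using sub that subseq_order.order_trans[of "[a, b, a]" "[a, b, a] @ [b]" "p @ q"] by auto
    consider "a \<in> set p" "b \<in> set p" | "a \<in> set p" "b \<notin> set p" | "a \<notin> set p" "b \<in> set p"
      | "a \<notin> set p" "b \<notin> set p" by blast
    then show False
    proof cases
      case 1
      have "filter (\<lambda>x. x \<in> set p) (1 # p @ q) = p"
        using p disj by (auto simp: filter_id_conv filter_empty_conv)
      then have "subseq [a, b, a, b] p"
        using subseq_filter[OF sub, of "\<lambda>x. x \<in> set p"] 1 by simp
      then show False using N ab by (auto simp: noncrossing_def)
    next
      case 2
      then show False using aba p not_subseq_interleaved[OF 2 disj] by metis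
    next
      case 3
      then show False using bab not_subseq_interleaved[OF 3(2,1) disj] by metis
    next
      case 4
      have "filter (\<lambda>x. x \<notin> set p) (1 # p @ q) = 1 # q"
        using p disj by (auto simp: filter_id_conv filter_empty_conv)
      then have sub: "subseq [a, b, a, b] (1 # q)"
        using subseq_filter[OF sub, of "\<lambda>x. x \<notin> set p"] 4 by simp
      \<comment> \<open>If the crossing starts at the added \<open>1\<close>, then \<open>q\<close>
        is nonempty and its own leading \<open>1\<close> can take that place.\<close>
      have "subseq [a, b, a, b] q"
      proof (cases "a = 1")
        case True
        with sub have *: "subseq [b, a, b] q" by simp
        then obtain q' where "q = 1 # q'" using q by (cases q) auto
        with * ab True show ?thesis by auto
      next
        case False
        with sub show ?thesis by simp
      qed
      then show False using N ab by (auto simp: noncrossing_def)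
    qed
  qed
qed

text \<open>The factored word of the opening outline; \<open>v'\<close> arises from \<open>v\<close>
  by reopening the gap for the letters of \<open>u\<close>.\<close>

definition glue :: "nat list \<Rightarrow> nat list \<Rightarrow> nat list" where
  "glue u v = 1 # map Suc u @ map (shift_letter 1 (fold max u 0)) v"

text \<open>Phrased for arbitrary words so that one equivalence serves both for composing members of
  \<open>NC\<close> and for taking one apart. The bound \<open>top\<close> keeps the letters of
  \<open>u\<close> apart from the relabelled ones of \<open>v\<close>.\<close>

lemma glue_in_NC_iff:
  assumes u: "0 \<notin> set u" and v: "0 \<notin> set v" "v = [] \<or> hd v = 1"
    and top: "set u \<subseteq> {1..fold max u 0}"
  shows "glue u v \<in> NC n \<longleftrightarrow> n = Suc (length u + length v) \<and> u \<in> NC (length u) \<and> v \<in> NC (length v)"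
proof -
  let ?K = "fold max u 0"
  have "rgf_from 0 (glue u v) \<longleftrightarrow> rgf_from 1 (map Suc u) \<and> rgf_from (1 + ?K) (map (shift_letter 1 ?K) v)"
    using fold_max_map_Suc[of u 0] by (simp add: glue_def rgf_from_append)
  also have "\<dots> \<longleftrightarrow> rgf_from 0 u \<and> rgf_from 1 v"
    using u v rgf_from_map_Suc[of u 0] rgf_from_shift_letter[of 1 ?K 1 v] by simp
  also have "\<dots> \<longleftrightarrow> rgf_from 0 u \<and> rgf_from 0 v"
    using rgf_from_0_iff[of v] v by simp
  finally have rgf: "rgf_from 0 (glue u v) \<longleftrightarrow> rgf_from 0 u \<and> rgf_from 0 v" .
  have "noncrossing (glue u v) \<longleftrightarrow> noncrossing (map Suc u) \<and> noncrossing (map (shift_letter 1 ?K) v)"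
    unfolding glue_def
  proof (rule noncrossing_first_block)
    show "1 \<notin> set (map Suc u)" using u by auto
    show "map (shift_letter 1 ?K) v = [] \<or> hd (map (shift_letter 1 ?K) v) = 1"
      using v by (cases v) (auto simp: shift_letter_def)
    show "set (map Suc u) \<inter> set (map (shift_letter 1 ?K) v) = {}"
    proof -
      have "Suc x \<noteq> shift_letter 1 ?K y" if "x \<in> set u" "y \<in> set v" for x y
      proof -
        have "0 < x" "x \<le> ?K" "0 < y" using that u v top by (auto intro!: Nat.gr0I)
        then show ?thesis by (auto simp: shift_letter_def)
      qed
      then show ?thesis by auto
    qed
  qed
  also have "\<dots> \<longleftrightarrow> noncrossing u \<and> noncrossing v"
    using noncrossing_map[of u Suc] noncrossing_map[OF strict_mono_on_shift_letter[of 1 ?K "set v"]] v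
    by (simp add: strict_mono_on_def)
  finally show ?thesis
    using rgf by (auto simp: NC_iff glue_def)
qed

lemma NC_letters:
  assumes "u \<in> NC i"
  shows "0 \<notin> set u" "u = [] \<or> hd u = 1" "set u = {1..fold max u 0}"
  using assms rgf_from_set[of 0 u] rgf_from_pos[of 0 u 0] rgf_from_0_iff[of u] by (auto simp: NC_iff)

lemma glue_NC:
  assumes "u \<in> NC i" "v \<in> NC j"
  shows "glue u v \<in> NC (Suc (i + j))"
  using glue_in_NC_iff[of u v] NC_letters[OF assms(1)] NC_letters[OF assms(2)] assms
  by (auto simp: NC_iff)

text \<open>The cut is made before the second \<open>1\<close> of \<open>w\<close>; if there is
  none, \<open>v\<close> is empty.\<close>

lemma NC_Suc_obtain_glue:
  assumes w: "w \<in> NC (Suc n)"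
  obtains i u v where "i \<le> n" "u \<in> NC i" "v \<in> NC (n - i)" "w = glue u v"
proof -
  obtain w' where w': "w = 1 # w'"
    using w NC_letters(2)[OF w] by (cases w) (auto simp: NC_iff)
  define p where "p = takeWhile (\<lambda>x. x \<noteq> 1) w'"
  define q where "q = dropWhile (\<lambda>x. x \<noteq> 1) w'"
  have wpq: "w = 1 # p @ q" by (simp add: w' p_def q_def)
  have p1: "1 \<notin> set p" by (auto simp: p_def dest: set_takeWhileD)
  have q1: "q = [] \<or> hd q = 1" using hd_dropWhile[of "\<lambda>x. x \<noteq> 1" w'] by (auto simp: q_def)
  have pos: "0 \<notin> set p" "0 \<notin> set q" using NC_letters(1)[OF w] by (auto simp: wpq)
  define u where "u = map (\<lambda>x. x - 1) p"
  define K where "K = fold max u 0"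
  \<comment> \<open>Meant as the inverse of \<open>shift_letter 1 K\<close>; this is justified once
    \<open>new\<close> shows that the letters of \<open>q\<close> other than \<open>1\<close> exceed
    \<open>K + 1\<close>.\<close>
  define v where "v = map (\<lambda>c. if c = 1 then 1 else c - K) q"
  have pu: "p = map Suc u"
    using pos by (auto simp: u_def o_def intro!: map_idI[symmetric] Suc_pred Nat.gr0I)
  have u0: "0 \<notin> set u" using p1 by (auto simp: pu)
  have "rgf_from 1 p"
    using w by (auto simp: NC_iff wpq rgf_from_append)
  then have setp: "{1..1} \<union> set p = {1..Suc K}"
    using rgf_from_set[of 1 p] fold_max_map_Suc[of u 0] by (simp add: pu K_def)
  have setu: "set u \<subseteq> {1..K}"
  proof
    fix x assume "x \<in> set u"
    then have "Suc x \<in> {1..1} \<union> set p" "x \<noteq> 0" using u0 by (simp add: pu, metis)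
    then have "Suc x \<in> {1..Suc K}" "x \<noteq> 0" unfolding setp by auto
    then show "x \<in> {1..K}" by (simp add: Suc_le_eq)
  qed
  \<comment> \<open>An old letter \<open>c\<close> of \<open>q\<close> would already occur in
    \<open>p\<close>, and \<open>1 c 1 c\<close> would be a crossing with the first block.\<close>
  have new: "Suc K < c" if c: "c \<in> set q" "c \<noteq> 1" for c
  proof (rule ccontr)
    assume "\<not> Suc K < c"
    then have "c \<in> set p" using setp c pos by (metis Un_iff atLeastAtMost_iff leI le_antisym Nat.gr0I One_nat_def Suc_leI)
    obtain q' where q': "q = 1 # q'" using q1 c by (cases q) auto
    then have "c \<in> set q'" using c by auto
    then have "subseq ([1] @ [c] @ [1] @ [c]) ([1] @ p @ [1] @ q')"
      using \<open>c \<in> set p\<close> by (intro list_emb_append_mono) (auto simp: subseq_singleton_left)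
    moreover have "1 < c" using c pos by (metis One_nat_def Suc_lessI Nat.gr0I)
    moreover have "[1] @ [c] @ [1] @ [c] = [1, c, 1, c]" "[1] @ p @ [1] @ q' = w"
      by (simp_all add: wpq q')
    ultimately show False using w unfolding NC_iff noncrossing_def by metis
  qed
  have qv: "q = map (shift_letter 1 K) v"
    using new by (auto simp: v_def o_def shift_letter_def intro!: map_idI[symmetric]) fastforce+
  have v0: "0 \<notin> set v"
    using new by (fastforce simp: v_def split: if_splits)
  have v1: "v = [] \<or> hd v = 1" using q1 by (cases q) (auto simp: v_def)
  have g: "w = glue u v" by (simp add: glue_def wpq pu qv K_def)
  have "u \<in> NC (length u)" "v \<in> NC (length v)" "Suc n = Suc (length u + length v)"
    using w glue_in_NC_iff[OF u0 v0 v1] setu by (auto simp: g K_def)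
  then show ?thesis using that[of "length u" u v] g by simp
qed

text \<open>\<open>u\<close> is read off between the first \<open>1\<close> and the next one, or the
  end of the word. It fixes the relabelling of \<open>v\<close>, which is injective.\<close>

lemma glue_inject:
  assumes "0 \<notin> set u" "0 \<notin> set u'" "0 \<notin> set v" "0 \<notin> set v'"
    "v = [] \<or> hd v = 1" "v' = [] \<or> hd v' = 1" and eq: "glue u v = glue u' v'"
  shows "u = u' \<and> v = v'"
proof -
  have tw: "takeWhile (\<lambda>x. x \<noteq> 1) (tl (glue u v)) = map Suc u" if "0 \<notin> set u" "v = [] \<or> hd v = 1" for u v
  proof -
    have "\<forall>x\<in>set (map Suc u). x \<noteq> 1"
      using that(1) by (metis One_nat_def Suc_inject imageE list.set_map)
    then have "takeWhile (\<lambda>x. x \<noteq> 1) (map Suc u @ q) = map Suc u @ takeWhile (\<lambda>x. x \<noteq> 1) q" for q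
      by (intro takeWhile_append2) auto
    moreover have "takeWhile (\<lambda>x. x \<noteq> 1) (map (shift_letter 1 K) v) = []" for K
      using that by (cases v) (auto simp: shift_letter_def)
    ultimately show ?thesis by (simp add: glue_def)
  qed
  have "map Suc u = map Suc u'" using tw assms by metis
  then have u: "u = u'" by (simp add: inj_map_eq_map)
  let ?f = "shift_letter 1 (fold max u 0)"
  have "map ?f v = map ?f v'" using eq u by (simp add: glue_def)
  moreover have "inj_on ?f (set v \<union> set v')"
    using assms by (intro strict_mono_on_imp_inj_on strict_mono_on_shift_letter) auto
  ultimately show ?thesis using u by (simp add: inj_on_map_eq_map)
qed

lemma iso_suffix_map:
  assumes "strict_mono_on (set u) f"
  shows "iso_suffix r (map f u) \<longleftrightarrow> iso_suffix r u"
proof -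
  have "order_isomorphic (map f y) r \<longleftrightarrow> order_isomorphic y r" if "u = s @ y" for s y
    using assms that by (intro order_isomorphic_map) (auto simp: strict_mono_on_def)
  then show ?thesis
    by (auto simp: iso_suffix_def map_eq_append_conv)
qed

lemma ones_prefix_iff: "ones_prefix b v \<longleftrightarrow> b \<le> length v \<and> (\<forall>i<b. v ! i = 1)"
proof
  assume "b \<le> length v \<and> (\<forall>i<b. v ! i = 1)"
  then have "take b v = replicate b 1" by (auto intro: nth_equalityI)
  then show "ones_prefix b v" unfolding ones_prefix_def by (metis append_take_drop_id)
qed (auto simp: ones_prefix_def nth_append)

lemma ones_prefix_shift_letter:
  assumes "0 \<notin> set v"
  shows "ones_prefix b (map (shift_letter 1 K) v) \<longleftrightarrow> ones_prefix b v"
proof -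
  have "shift_letter 1 K (v ! i) = 1 \<longleftrightarrow> v ! i = 1" if "i < length v" for i
  proof -
    have "v ! i \<noteq> 0" using that assms nth_mem by metis
    then show ?thesis by (auto simp: shift_letter_def)
  qed
  then show ?thesis by (auto simp: ones_prefix_iff shift_letter_def)
qed

text \<open>The leading \<open>1\<close> starts no occurrence and both relabellings preserve counts,
  so the only extra term comes from the seam.\<close>

lemma occurrences_glue:
  assumes r: "\<forall>x\<in>set r. 0 < x" "r \<noteq> []" and b: "0 < b"
    and u: "0 \<notin> set u" and v: "0 \<notin> set v" "v = [] \<or> hd v = 1"
  shows "occurrences (pattern r b) (glue u v) = occurrences (pattern r b) u + occurrences (pattern r b) v
     + of_bool (iso_suffix r u \<and> ones_prefix b v)"
proof -
  let ?f = "shift_letter 1 (fold max u 0)"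
  have Suc: "strict_mono_on (set u) Suc" by (simp add: strict_mono_on_def)
  have f: "strict_mono_on (set v) ?f" using v by (intro strict_mono_on_shift_letter) auto
  have pos: "0 < x" if "x \<in> set u \<union> set v" for x
    using that u v by (auto intro!: Nat.gr0I)
  have "occurrences (pattern r b) (glue u v) = occurrences (pattern r b) (map Suc u @ map ?f v)"
    unfolding glue_def by (rule occurrences_pattern_one_Cons[OF r b]) (use pos in \<open>auto simp: shift_letter_def\<close>)
  also have "\<dots> = occurrences (pattern r b) (map Suc u) + occurrences (pattern r b) (map ?f v)
     + of_bool (iso_suffix r (map Suc u) \<and> ones_prefix b (map ?f v))"
    by (rule occurrences_pattern_append[OF r b])
       (use v pos in \<open>cases v; auto simp: shift_letter_def\<close>)+
  finally show ?thesis
    by (simp only: occurrences_map[OF Suc] occurrences_map[OF f] iso_suffix_map[OF Suc] ones_prefix_shift_letter[OF v(1)])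
qed

section \<open>Words ending in a copy of rho\<close>

text \<open>Only \<open>m\<close> can occur on both sides of the seam. Cutting
  \<open>a b a b\<close> there leaves the mixed cases \<open>a = m\<close>, completed to a crossing
  by the \<open>m\<close> in front of \<open>y\<close>, and \<open>b = m\<close>, completed by the
  \<open>m\<close> after \<open>s\<close>.\<close>

lemma noncrossing_extend:
  assumes s: "noncrossing (s @ [m])" and y: "noncrossing (m # y)"
    and new: "\<forall>x\<in>set y. x = m \<or> x \<notin> set s \<and> m < x"
  shows "noncrossing (s @ m # y)"
  unfolding noncrossing_def
proof clarify
  fix a b assume ab: "a < b" and sub: "subseq [a, b, a, b] (s @ m # y)"
  from sub obtain us vs where uv: "[a, b, a, b] = us @ vs" "subseq us s" "subseq vs (m # y)"
    by (rule subseq_appendE)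
  have sets: "set us \<subseteq> set s" "set vs \<subseteq> set (m # y)"
    using uv subseq_imp_subset by blast+
  have m: "x = m" if "x \<in> set us" "x \<in> set vs" for x
    using sets that new by auto
  have "us = [] \<and> vs = [a, b, a, b] \<or> us = [a] \<and> vs = [b, a, b] \<or> us = [a, b] \<and> vs = [a, b]
    \<or> us = [a, b, a] \<and> vs = [b] \<or> us = [a, b, a, b] \<and> vs = []"
    using uv(1)[symmetric] unfolding append_eq_Cons_conv append_is_Nil_conv by blast
  then consider "us = []" "vs = [a, b, a, b]" | "us = [a]" "vs = [b, a, b]" | "us = [a, b]" "vs = [a, b]"
    | "us = [a, b, a]" "vs = [b]" | "us = [a, b, a, b]" "vs = []"
    by blast
  then show False
  proof cases
    case 1
    then show False using uv(3) y ab unfolding noncrossing_def by blast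
  next
    case 2
    then have "a = m" using m by auto
    have "subseq [b, m, b] (m # y)" using uv(3) 2 \<open>a = m\<close> by simp
    then have "subseq [b, m, b] y" using ab \<open>a = m\<close> by simp
    then have "subseq [m, b, m, b] (m # y)" by simp
    then show False using y ab \<open>a = m\<close> unfolding noncrossing_def by blast
  next
    case 3
    then show False using m[of a] m[of b] ab by simp
  next
    case 4
    then have "b = m" using m by auto
    with 4 uv have "subseq ([a, b, a] @ [b]) (s @ [m])"
      by (intro list_emb_append_mono) simp_all
    then have "subseq [a, b, a, b] (s @ [m])" by simp
    then show False using s ab unfolding noncrossing_def by blast
  next
    case 5
    then have "subseq [a, b, a, b] (s @ [m])" using uv subseq_rev_drop_many by blast
    then show False using s ab unfolding noncrossing_def by blast
  qed
qed

text \<open>Undoes the truncation: the last letter \<open>m\<close> grows into a copy of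
  \<open>1 # r\<close> in which \<open>1\<close> becomes \<open>m\<close> and all larger letters are
  new. The shift is \<open>K - 1\<close> because the letters in use are
  \<open>{1..K}\<close>.\<close>

lemma NC_extend:
  assumes w: "s @ [m] \<in> NC (Suc n)" and r: "1 # r \<in> NC (Suc l)"
  defines "K \<equiv> fold max (s @ [m]) 0"
  shows "s @ map (shift_letter m (K - 1)) (1 # r) \<in> NC (Suc (n + l))"
proof -
  let ?f = "shift_letter m (K - 1)"
  have K: "set (s @ [m]) = {1..K}" using NC_letters(3)[OF w] by (simp add: K_def)
  then have "m \<in> {1..K}" by auto
  then have m: "1 \<le> m" "m \<le> K" by auto
  have r0: "0 \<notin> set r" using NC_letters(1)[OF r] by auto
  have "rgf_from (1 + (K - 1)) (map ?f r)"
    using r r0 m rgf_from_shift_letter[of m "K - 1" 1 r] by (simp add: NC_iff)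
  then have "rgf_from 0 ((s @ [m]) @ map ?f r)"
    unfolding rgf_from_append using w m by (simp add: NC_iff rgf_from_append K_def)
  then have rgf: "rgf_from 0 (s @ map ?f (1 # r))" by (simp add: shift_letter_def)
  have f: "strict_mono_on (set (1 # r)) ?f"
    using r0 m by (intro strict_mono_on_shift_letter) auto
  have "noncrossing (s @ m # map ?f r)"
  proof (rule noncrossing_extend)
    show "noncrossing (s @ [m])" using w by (simp add: NC_iff)
    have "noncrossing (map ?f (1 # r))"
      using noncrossing_map[OF f] r by (simp add: NC_iff)
    then show "noncrossing (m # map ?f r)" by (simp add: shift_letter_def)
    show "\<forall>x\<in>set (map ?f r). x = m \<or> x \<notin> set s \<and> m < x"
    proof
      fix x assume "x \<in> set (map ?f r)"
      then obtain c where c: "c \<in> set r" "x = ?f c" by auto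
      show "x = m \<or> x \<notin> set s \<and> m < x"
      proof (cases "c = 1")
        case True
        then show ?thesis using c by (simp add: shift_letter_def)
      next
        case False
        then have "1 < c" using c r0 by (metis One_nat_def Suc_lessI Nat.gr0I)
        then have "K < x" using c m by (auto simp: shift_letter_def)
        moreover have "set s \<subseteq> {1..K}" using K by auto
        ultimately show ?thesis using m by fastforce
      qed
    qed
  qed
  then have "noncrossing (s @ map ?f (1 # r))" by (simp add: shift_letter_def)
  with rgf show ?thesis using w r by (simp add: NC_iff)
qed

text \<open>The relabelling is forced: restricted growth of the image bounds each new letter above
  by the next free value, and monotonicity pushes it at least that high.\<close>

lemma rgf_from_map_unique:
  assumes "rgf_from j v" "rgf_from (j + K) (map h v)" "0 < j" "m \<le> Suc K"
    "strict_mono_on ({1..j} \<union> set v) h" "\<forall>c\<in>{1..j}. h c = shift_letter m K c"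
    "\<forall>c\<in>set v. 1 < c \<longrightarrow> Suc K < h c"
  shows "map h v = map (shift_letter m K) v"
  using assms
proof (induction v arbitrary: j)
  case (Cons c v)
  have c: "0 < c" "c \<le> Suc j" "h c \<le> Suc (j + K)" using Cons.prems by auto
  show ?case
  proof (cases "c \<le> j")
    case True
    then have hc: "h c = shift_letter m K c" using Cons.prems(6) c by auto
    then have "max (j + K) (h c) = j + K" "max j c = j"
      using True Cons.prems c by (auto simp: shift_letter_def)
    then have "map h v = map (shift_letter m K) v"
      using Cons.prems by (intro Cons.IH[of j]) (auto simp: strict_mono_on_def)
    then show ?thesis using hc by simp
  next
    case False
    then have cj: "c = Suc j" using c by simp
    \<comment> \<open>For \<open>j = 1\<close> the preceding letter goes to \<open>m\<close>,
      possibly far below \<open>1 + K\<close>, so monotonicity is too weak; the bound assumed for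
      letters above \<open>1\<close> steps in.\<close>
    have "j + K < h c"
    proof (cases "j = 1")
      case True
      then show ?thesis using Cons.prems(7) cj by auto
    next
      case False
      have "h j < h c" using Cons.prems(3,5) cj by (auto simp: strict_mono_on_def)
      moreover have "h j = j + K" using Cons.prems(3,6) False by (auto simp: shift_letter_def)
      ultimately show ?thesis by simp
    qed
    then have hc: "h c = Suc j + K" using c by simp
    then have hc': "h c = shift_letter m K c" using cj Cons.prems(3) by (simp add: shift_letter_def)
    have "{1..Suc j} = insert (Suc j) {1..j}" by auto
    then have "map h v = map (shift_letter m K) v"
      using Cons.prems hc hc' cj by (intro Cons.IH[of "Suc j"]) auto
    then show ?thesis using hc' by simp
  qed
qed simp

text \<open>The prefix \<open>s @ [m]\<close> determines the suffix: \<open>m\<close> is the image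
  of \<open>1\<close>, and every other letter of \<open>r\<close> must go to a new letter, in order
  of appearance.\<close>

lemma NC_iso_suffix_unique:
  assumes w: "s @ y \<in> NC n" and iso: "order_isomorphic y (1 # r)" and r: "1 # r \<in> NC l"
  obtains m where "s @ [m] \<in> NC (Suc (length s))"
    "y = map (shift_letter m (fold max (s @ [m]) 0 - 1)) (1 # r)"
proof -
  obtain h where h: "strict_mono_on (set (1 # r)) h" "y = map h (1 # r)"
    using iso by (auto simp: order_isomorphic_iff_map)
  define m where "m = h 1"
  define K where "K = fold max (s @ [m]) 0"
  have w': "s @ m # map h r = (s @ [m]) @ map h r" by simp
  have wm: "s @ m # map h r \<in> NC n" using w h by (simp add: m_def)
  have "subseq (s @ [m]) (s @ m # map h r)"
    unfolding w' by (simp add: subseq_rev_drop_many del: append_assoc)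
  then have "noncrossing (s @ [m])"
    using wm noncrossing_subseq by (auto simp: NC_iff)
  moreover have rgf: "rgf_from 0 (s @ [m])" "rgf_from K (map h r)"
    using wm unfolding NC_iff w' by (simp_all add: rgf_from_append K_def max.commute)
  ultimately have sm: "s @ [m] \<in> NC (Suc (length s))"
    by (simp add: NC_iff)
  have setK: "set (s @ [m]) = {1..K}" using NC_letters(3)[OF sm] by (simp add: K_def)
  then have "m \<in> {1..K}" by auto
  then have m: "1 \<le> m" "m \<le> K" by auto
  \<comment> \<open>If \<open>h c\<close> were old, it would occur in \<open>s\<close>, preceded by
    the smaller \<open>m\<close> because of restricted growth; the suffix then repeats
    \<open>m\<close> and \<open>h c\<close>, which is a crossing.\<close>
  have new: "K < h c" if c: "c \<in> set r" "1 < c" for c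
  proof (rule ccontr)
    assume "\<not> K < h c"
    have "m < h c" using h(1) c by (auto simp: m_def strict_mono_on_def)
    with \<open>\<not> K < h c\<close> m have "h c \<in> set (s @ [m])" unfolding setK by simp
    with \<open>m < h c\<close> obtain i where i: "i < length s" "s ! i = h c"
      by (auto simp: in_set_conv_nth)
    have "rgf_from 0 s" using rgf by (simp add: rgf_from_append)
    then have "m \<in> set (take i s)"
      using i m \<open>m < h c\<close> unfolding rgf_from_nth_iff by fastforce
    then have "subseq ([m] @ [h c] @ [m] @ [h c]) (take i s @ drop i s @ [m] @ map h r)"
      using i c by (intro list_emb_append_mono)
        (auto simp: subseq_singleton_left simp flip: Cons_nth_drop_Suc)
    then have "subseq [m, h c, m, h c] (s @ m # map h r)"
      by (metis append_Cons append_Nil append_assoc append_take_drop_id)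
    then show False using wm \<open>m < h c\<close> by (auto simp: NC_iff noncrossing_def)
  qed
  have "map h r = map (shift_letter m (K - 1)) r"
  proof (rule rgf_from_map_unique[of 1])
    show "rgf_from 1 r" using r by (simp add: NC_iff)
    show "rgf_from (1 + (K - 1)) (map h r)" using rgf m by simp
    show "strict_mono_on ({1..1} \<union> set r) h" using h by simp
    show "\<forall>c\<in>{1..1}. h c = shift_letter m (K - 1) c" by (simp add: shift_letter_def m_def)
    show "\<forall>c\<in>set r. 1 < c \<longrightarrow> Suc (K - 1) < h c" using new m by simp
  qed (use m in auto)
  then have "y = map (shift_letter m (K - 1)) (1 # r)"
    using h by (simp add: shift_letter_def m_def)
  then show ?thesis using that sm by (simp add: K_def)
qed

text \<open>Cutting off \<open>y\<close> loses no occurrence. As \<open>m # y\<close> is only as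
  long as \<open>r\<close>, an occurrence starts in \<open>s\<close>. If it reached into
  \<open>y\<close>, its smallest letter \<open>k\<close>, standing at its end, would be at least
  \<open>m\<close>; then \<open>m\<close> lies in the final run and the letter after it equals
  \<open>m\<close> too, against \<open>single\<close>.\<close>

lemma occurrences_extend:
  assumes r: "\<forall>x\<in>set r. 0 < x" and b: "0 < b"
    and len: "length r = Suc (length y)" and y: "\<forall>x\<in>set y. m \<le> x"
    and single: "2 \<le> b \<Longrightarrow> y = [] \<or> hd y \<noteq> m"
  shows "occurrences (pattern r b) (s @ m # y) = occurrences (pattern r b) (s @ [m])"
proof (induction s)
  case Nil
  have "occurrences (pattern r b) w = 0" if "length w \<le> length r" for w
    using that b by (simp add: occurrences_def)
  then show ?case using len by simp
next
  case (Cons x s)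
  have ne: "pattern r b \<noteq> []" using b by (simp add: pattern_def)
  have pre: "iso_prefix (pattern r b) (s @ m # y) \<longleftrightarrow> iso_prefix (pattern r b) (s @ [m])" for s
  proof (cases "length r + b \<le> Suc (length s)")
    case True
    then have "take (length r + b) ((s @ [m]) @ y) = take (length r + b) (s @ [m])"
      by (subst take_append) simp
    then show ?thesis using True by (simp add: iso_prefix_def)
  next
    case False
    have "\<not> iso_prefix (pattern r b) (s @ m # y)"
    proof
      assume "iso_prefix (pattern r b) (s @ m # y)"
      then obtain z k t where z: "s @ m # y = z @ replicate b k @ t" "order_isomorphic z r"
        "\<forall>x\<in>set z. k < x"
        using iso_prefix_pattern[OF r b] by blast
      have lz: "length z = length r" using z(2) order_isomorphic_length by blast
      have "length (s @ m # y) = length z + b + length t" using z(1) by simp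
      then have lt: "length s = b + length t" "length t < length y"
        using lz len False by auto
      have at_z: "(s @ m # y) ! i \<in> set z" if "i < length z" for i
        unfolding z(1) using that by (simp add: nth_append)
      have at_k: "(s @ m # y) ! i = k" if "length z \<le> i" "i < length z + b" for i
        unfolding z(1) using that by (auto simp: nth_append)
      have at_y: "(s @ m # y) ! i \<in> set y" if "length s < i" "i \<le> length s + length y" for i
        using that by (auto simp: nth_append nth_Cons')
      have at_m: "(s @ m # y) ! length s = m" by simp
      \<comment> \<open>The index \<open>length z + b - 1\<close> is the last one of the window,
        which in this case lies beyond \<open>m\<close>.\<close>
      have "k \<in> set y"
        using at_k[of "length z + b - 1"] at_y[of "length z + b - 1"] b lt lz len by auto
      then have "m \<le> k" using y by blast
      have "length z \<le> length s"
        using at_z[of "length s"] at_m z(3) \<open>m \<le> k\<close> by (metis leD leI)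
      then have "m = k" using at_k[of "length s"] at_m lt lz len by simp
      moreover have "(s @ m # y) ! Suc (length s) = k"
        using at_k \<open>length z \<le> length s\<close> lt lz len by simp
      ultimately have "hd y = m" using lt by (cases y) (auto simp: nth_append)
      moreover have "2 \<le> b" using lt lz len \<open>length z \<le> length s\<close> by linarith
      ultimately show False using single lt by auto
    qed
    then show ?thesis using False by (simp add: iso_prefix_def)
  qed
  show ?case
    using Cons pre[of "x # s"] by (simp add: occurrences_Cons[OF ne])
qed

section \<open>Generating polynomials and weight-preserving bijections\<close>

text \<open>This is \<open>F_n\<close> with \<open>monom 1 1\<close> as \<open>q\<close>; integer
  coefficients make \<open>q - 1\<close> available.\<close>

definition occ_poly :: "nat list \<Rightarrow> nat \<Rightarrow> nat \<Rightarrow> int poly" where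
  "occ_poly r b n = (\<Sum>w\<in>NC n. monom 1 (occurrences (pattern r b) w))"

lemma coeff_occ_poly:
  "coeff (occ_poly r b n) k = int (card {w \<in> NC n. occurrences (pattern r b) w = k})"
  using finite_NC[of n] by (simp add: occ_poly_def coeff_sum sum.If_cases Int_def)

lemma NC_0: "NC 0 = {[]}"
  by (auto simp: NC_iff noncrossing_def)

text \<open>The inverse keeps the first \<open>n + 1\<close> letters, that is, it cuts right after
  the first letter of the suffix.\<close>

lemma bij_betw_NC_iso_suffix:
  assumes r: "1 # r \<in> NC (Suc l)"
  shows "bij_betw (\<lambda>w. butlast w @ map (shift_letter (last w) (fold max w 0 - 1)) (1 # r))
    (NC (Suc n)) {w \<in> NC (Suc (n + l)). iso_suffix (1 # r) w}"
  (is "bij_betw ?E _ ?B")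
proof (rule bij_betwI')
  have take_E: "take (Suc n) (?E w) = w" if "w \<in> NC (Suc n)" for w
  proof -
    have "length (butlast w) = n" "w \<noteq> []" using that by (auto simp: NC_iff)
    then show ?thesis by (simp add: shift_letter_def)
  qed
  show "?E w = ?E w' \<longleftrightarrow> w = w'" if "w \<in> NC (Suc n)" "w' \<in> NC (Suc n)" for w w'
    using take_E that by metis
  show "?E w \<in> ?B" if w: "w \<in> NC (Suc n)" for w
  proof -
    have ne: "w \<noteq> []" using w by (auto simp: NC_iff)
    let ?f = "shift_letter (last w) (fold max w 0 - 1)"
    have "?E w \<in> NC (Suc (n + l))"
      using NC_extend[of "butlast w" "last w" n r l] w r ne by simp
    moreover have "strict_mono_on (set (1 # r)) ?f"
    proof (rule strict_mono_on_shift_letter)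
      have "last w \<in> {1..fold max w 0}" using NC_letters(3)[OF w] ne last_in_set by blast
      then show "last w \<le> Suc (fold max w 0 - 1)" by simp
      show "0 \<notin> set (1 # r)" using NC_letters(1)[OF r] .
    qed
    then have "iso_suffix (1 # r) (?E w)"
      unfolding iso_suffix_def order_isomorphic_iff_map by blast
    ultimately show ?thesis by simp
  qed
  show "\<exists>w'\<in>NC (Suc n). w = ?E w'" if w: "w \<in> ?B" for w
  proof -
    obtain s y where sy: "w = s @ y" "order_isomorphic y (1 # r)"
      using w by (auto simp: iso_suffix_def)
    have "length y = Suc l" using order_isomorphic_length[OF sy(2)] r by (simp add: NC_iff)
    then have "length s = n" using w sy by (simp add: NC_iff)
    moreover obtain m where m: "s @ [m] \<in> NC (Suc (length s))"
      "y = map (shift_letter m (fold max (s @ [m]) 0 - 1)) (1 # r)"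
      using NC_iso_suffix_unique[of s y _ r] w sy r by blast
    ultimately show ?thesis
      using sy by (intro bexI[of _ "s @ [m]"]) auto
  qed
qed

text \<open>Truncation drops \<open>l\<close> letters and no occurrence. The inequality is strict
  because the suffix has \<open>l + 1\<close> letters: at \<open>i = l\<close> the sum is empty,
  although \<open>occ_poly\<close> at \<open>0\<close> is not zero.\<close>

lemma sum_iso_suffix:
  assumes r: "1 # r \<in> NC (Suc l)" and b: "0 < b"
    and single: "2 \<le> b \<Longrightarrow> r = [] \<or> hd r \<noteq> 1"
  shows "(\<Sum>w | w \<in> NC i \<and> iso_suffix (1 # r) w. monom (1::int) (occurrences (pattern (1 # r) b) w)) =
    (if l < i then occ_poly (1 # r) b (i - l) else 0)"
proof (cases "l < i")
  case True
  then obtain n where n: "i = Suc (n + l)" using less_imp_Suc_add by (metis add.commute)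
  have pos: "\<forall>x\<in>set (1 # r). 0 < x"
    using NC_letters(1)[OF r] by (metis Nat.gr0I)
  have occ: "occurrences (pattern (1 # r) b) (butlast w @ map (shift_letter (last w) (fold max w 0 - 1)) (1 # r))
    = occurrences (pattern (1 # r) b) w" if w: "w \<in> NC (Suc n)" for w
  proof -
    let ?K = "fold max w 0"
    let ?f = "shift_letter (last w) (?K - 1)"
    have ne: "w \<noteq> []" using w by (auto simp: NC_iff)
    have "last w \<in> {1..?K}" using NC_letters(3)[OF w] ne last_in_set by blast
    then have m: "last w \<le> ?K" by simp
    have "?f c \<ge> last w" "c \<noteq> 1 \<Longrightarrow> ?f c \<noteq> last w" if "c \<in> set r" for c
      using pos that m by (auto simp: shift_letter_def)
    then have "occurrences (pattern (1 # r) b) (butlast w @ last w # map ?f r)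
       = occurrences (pattern (1 # r) b) (butlast w @ [last w])"
      using pos b single by (intro occurrences_extend) (auto simp: hd_map)
    then show ?thesis using ne by (simp add: shift_letter_def)
  qed
  have "(\<Sum>w | w \<in> NC i \<and> iso_suffix (1 # r) w. monom (1::int) (occurrences (pattern (1 # r) b) w)) =
      (\<Sum>w\<in>NC (Suc n). monom 1 (occurrences (pattern (1 # r) b)
        (butlast w @ map (shift_letter (last w) (fold max w 0 - 1)) (1 # r))))"
    unfolding n by (rule sum.reindex_bij_betw[OF bij_betw_NC_iso_suffix[OF r], symmetric])
  also have "\<dots> = occ_poly (1 # r) b (Suc n)"
    unfolding occ_poly_def by (intro sum.cong refl arg_cong[of _ _ "monom 1"] occ)
  finally show ?thesis using n by simp
next
  case False
  have "length w > l" if "iso_suffix (1 # r) w" for w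
    using that r by (auto simp: iso_suffix_def NC_iff dest: order_isomorphic_length)
  then have "{w. w \<in> NC i \<and> iso_suffix (1 # r) w} = {}"
    using False by (auto simp: NC_iff)
  then show ?thesis using False by (simp only: sum.empty if_False)
qed

lemma rgf_from_1_replicate: "rgf_from 1 (replicate k 1 @ w) \<longleftrightarrow> rgf_from 1 w"
  by (induction k) auto

lemma noncrossing_replicate: "noncrossing (replicate k 1 @ 1 # w) \<longleftrightarrow> noncrossing (1 # w)"
proof (induction k)
  case (Suc k)
  have "noncrossing (1 # [] @ replicate k 1 @ 1 # w) \<longleftrightarrow>
      noncrossing [] \<and> noncrossing (replicate k 1 @ 1 # w)"
    by (rule noncrossing_first_block) (auto simp: hd_append)
  then show ?case using Suc by (simp add: noncrossing_def)
qed simp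

lemma NC_ones_prefix_iff: "replicate k 1 @ 1 # w \<in> NC (n + k) \<longleftrightarrow> 1 # w \<in> NC n"
proof -
  have "rgf_from 0 (replicate k 1 @ 1 # w) \<longleftrightarrow> rgf_from 0 (1 # w)"
    using rgf_from_0_iff[of "replicate k 1 @ 1 # w"] rgf_from_0_iff[of "1 # w"]
      rgf_from_1_replicate[of k "1 # w"] by (auto simp: hd_append)
  then show ?thesis using noncrossing_replicate by (auto simp: NC_iff)
qed

text \<open>One \<open>1\<close> of the run of length \<open>b = Suc k\<close> is kept. Every
  nonempty word in \<open>NC\<close> starts with \<open>1\<close>, so what remains ranges over all
  of \<open>NC (Suc n)\<close>.\<close>

lemma bij_betw_NC_ones_prefix:
  "bij_betw (\<lambda>w. replicate k 1 @ w) (NC (Suc n)) {w \<in> NC (Suc n + k). ones_prefix (Suc k) w}"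
proof (rule bij_betwI')
  fix w assume w: "w \<in> NC (Suc n)"
  then obtain w' where w': "w = 1 # w'"
    using NC_letters(2)[OF w] by (cases w) (auto simp: NC_iff)
  then show "replicate k 1 @ w \<in> {w \<in> NC (Suc n + k). ones_prefix (Suc k) w}"
    using w NC_ones_prefix_iff[of k w' "Suc n"]
    by (auto simp: ones_prefix_def replicate_app_Cons_same simp flip: append_Cons)
next
  fix w assume "w \<in> {w \<in> NC (Suc n + k). ones_prefix (Suc k) w}"
  then obtain t where t: "w = replicate k 1 @ 1 # t" "w \<in> NC (Suc n + k)"
    by (auto simp: ones_prefix_def replicate_app_Cons_same)
  then show "\<exists>w'\<in>NC (Suc n). w = replicate k 1 @ w'"
    using NC_ones_prefix_iff by blast
qed simp

text \<open>The \<open>k\<close> removed ones start no occurrence, so the weight is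
  unchanged.\<close>

lemma sum_ones_prefix:
  assumes r: "\<forall>x\<in>set r. 0 < x" "r \<noteq> []"
  shows "(\<Sum>w | w \<in> NC j \<and> ones_prefix (Suc k) w. monom (1::int) (occurrences (pattern r (Suc k)) w)) =
    (if k < j then occ_poly r (Suc k) (j - k) else 0)"
proof (cases "k < j")
  case True
  then obtain n where n: "j = Suc n + k" using less_imp_Suc_add by (metis add.commute add_Suc)
  have occ: "occurrences (pattern r (Suc k)) (replicate i 1 @ w) = occurrences (pattern r (Suc k)) w"
    if w: "w \<in> NC (Suc n)" for w i
  proof (induction i)
    case (Suc i)
    have "\<forall>x\<in>set (replicate i 1 @ w). 0 < x"
      using NC_letters(1)[OF w] by (auto intro!: Nat.gr0I)
    from occurrences_pattern_one_Cons[OF r zero_less_Suc this]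
    have "occurrences (pattern r (Suc k)) (1 # replicate i 1 @ w) =
        occurrences (pattern r (Suc k)) (replicate i 1 @ w)" .
    then show ?case unfolding Suc.IH by (simp only: replicate_Suc append_Cons)
  qed simp
  have "(\<Sum>w | w \<in> NC j \<and> ones_prefix (Suc k) w. monom (1::int) (occurrences (pattern r (Suc k)) w)) =
      (\<Sum>w\<in>NC (Suc n). monom 1 (occurrences (pattern r (Suc k)) (replicate k 1 @ w)))"
    unfolding n by (rule sum.reindex_bij_betw[OF bij_betw_NC_ones_prefix, symmetric])
  also have "\<dots> = occ_poly r (Suc k) (Suc n)"
    unfolding occ_poly_def by (intro sum.cong refl arg_cong[of _ _ "monom 1"] occ)
  finally show ?thesis using n by simp
next
  case False
  then have "{w. w \<in> NC j \<and> ones_prefix (Suc k) w} = {}"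
    by (auto simp: NC_iff ones_prefix_iff)
  then show ?thesis using False by (simp only: sum.empty if_False)
qed

section \<open>The recursion and its consequence\<close>

lemma bij_betw_glue:
  "bij_betw (\<lambda>(i, u, v). glue u v) (SIGMA i:{..n}. NC i \<times> NC (n - i)) (NC (Suc n))"
proof (rule bij_betwI')
  fix x y assume xy: "x \<in> (SIGMA i:{..n}. NC i \<times> NC (n - i))" "y \<in> (SIGMA i:{..n}. NC i \<times> NC (n - i))"
  obtain i u v where x: "x = (i, u, v)" by (cases x)
  obtain i' u' v' where y: "y = (i', u', v')" by (cases y)
  have NC: "u \<in> NC i" "v \<in> NC (n - i)" "u' \<in> NC i'" "v' \<in> NC (n - i')"
    using xy x y by auto
  show "(case x of (i, u, v) \<Rightarrow> glue u v) = (case y of (i, u, v) \<Rightarrow> glue u v) \<longleftrightarrow> x = y"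
  proof
    assume "(case x of (i, u, v) \<Rightarrow> glue u v) = (case y of (i, u, v) \<Rightarrow> glue u v)"
    then have "u = u' \<and> v = v'"
      using NC[THEN NC_letters(1)] NC[THEN NC_letters(2)] x y by (intro glue_inject) auto
    then show "x = y" using NC x y by (auto simp: NC_iff)
  qed simp
next
  fix x assume "x \<in> (SIGMA i:{..n}. NC i \<times> NC (n - i))"
  then show "(case x of (i, u, v) \<Rightarrow> glue u v) \<in> NC (Suc n)"
    using glue_NC by fastforce
next
  fix w assume "w \<in> NC (Suc n)"
  then show "\<exists>x\<in>(SIGMA i:{..n}. NC i \<times> NC (n - i)). w = (case x of (i, u, v) \<Rightarrow> glue u v)"
    by (elim NC_Suc_obtain_glue) force
qed

text \<open>Besides the values of \<open>F\<close>, the pattern enters the right-hand side only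
  through \<open>l + k\<close>, which is \<open>a + b - 2\<close> in the notation of the
  theorem.\<close>

lemma occ_poly_rec:
  assumes r: "1 # r \<in> NC (Suc l)" and single: "1 \<le> k \<Longrightarrow> r = [] \<or> hd r \<noteq> 1"
  defines "F \<equiv> occ_poly (1 # r) (Suc k)"
  shows "F (Suc n) = (\<Sum>i\<le>n. F i * F (n - i)) +
    (monom 1 1 - 1) * (\<Sum>i\<in>{1..<n - (l + k)}. F i * F (n - (l + k) - i))"
proof -
  let ?X = "\<lambda>w. monom (1::int) (occurrences (pattern (1 # r) (Suc k)) w)"
  let ?s = "iso_suffix (1 # r)" and ?o = "ones_prefix (Suc k)"
  have pos: "\<forall>x\<in>set (1 # r). 0 < x"
    using NC_letters(1)[OF r] by (metis Nat.gr0I)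
  \<comment> \<open>\<open>q\<close> to the power \<open>of_bool P\<close> is
    \<open>1 + (q - 1) * of_bool P\<close>, and the seam indicator is a product of a condition on
    \<open>u\<close> and one on \<open>v\<close>; so the double sum factors.\<close>
  have X_glue: "?X (glue u v) = ?X u * ?X v + (monom 1 1 - 1) * ((of_bool (?s u) * ?X u) * (of_bool (?o v) * ?X v))"
    if "u \<in> NC i" "v \<in> NC j" for u v i j
  proof -
    have "?X (glue u v) = ?X u * ?X v * monom 1 (of_bool (?s u \<and> ?o v))"
      using occurrences_glue[OF pos, of "Suc k" u v] NC_letters[OF that(1)] NC_letters[OF that(2)]
      by (simp add: mult_monom)
    then show ?thesis by (auto simp: algebra_simps simp flip: one_pCons)
  qed
  have sum_if: "(\<Sum>w\<in>NC i. of_bool (P w) * ?X w) = (\<Sum>w | w \<in> NC i \<and> P w. ?X w)" for P i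
    using finite_NC[of i] by (intro sum.mono_neutral_cong_right) auto
  have S: "(\<Sum>w\<in>NC i. of_bool (?s w) * ?X w) = (if l < i then F (i - l) else 0)" for i
    unfolding sum_if F_def using single by (intro sum_iso_suffix[OF r]) auto
  have O: "(\<Sum>w\<in>NC i. of_bool (?o w) * ?X w) = (if k < i then F (i - k) else 0)" for i
    unfolding sum_if F_def using pos by (intro sum_ones_prefix) auto
  have "F (Suc n) = (\<Sum>(i, u, v)\<in>(SIGMA i:{..n}. NC i \<times> NC (n - i)). ?X (glue u v))"
    unfolding F_def occ_poly_def
    by (subst sum.reindex_bij_betw[OF bij_betw_glue, symmetric]) (simp add: case_prod_unfold)
  also have "\<dots> = (\<Sum>i\<le>n. \<Sum>(u, v)\<in>NC i \<times> NC (n - i). ?X (glue u v))"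
    by (subst sum.Sigma) (auto simp: finite_NC)
  also have "\<dots> = (\<Sum>i\<le>n. \<Sum>u\<in>NC i. \<Sum>v\<in>NC (n - i). ?X (glue u v))"
    by (simp add: sum.cartesian_product)
  also have "\<dots> = (\<Sum>i\<le>n. F i * F (n - i) + (monom 1 1 - 1) *
      ((if l < i then F (i - l) else 0) * (if k < n - i then F (n - i - k) else 0)))"
  proof (rule sum.cong)
    fix i
    have "(\<Sum>u\<in>NC i. \<Sum>v\<in>NC (n - i). ?X (glue u v)) = (\<Sum>u\<in>NC i. \<Sum>v\<in>NC (n - i).
        ?X u * ?X v + (monom 1 1 - 1) * ((of_bool (?s u) * ?X u) * (of_bool (?o v) * ?X v)))"
      by (intro sum.cong refl X_glue)
    also have "\<dots> = (\<Sum>u\<in>NC i. ?X u) * (\<Sum>v\<in>NC (n - i). ?X v) + (monom 1 1 - 1) *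
        ((\<Sum>u\<in>NC i. of_bool (?s u) * ?X u) * (\<Sum>v\<in>NC (n - i). of_bool (?o v) * ?X v))"
      by (simp only: sum.distrib flip: sum_distrib_left sum_distrib_right)
    also have "\<dots> = F i * F (n - i) + (monom 1 1 - 1) *
      ((if l < i then F (i - l) else 0) * (if k < n - i then F (n - i - k) else 0))"
      unfolding S O by (simp add: F_def occ_poly_def)
    finally show "(\<Sum>u\<in>NC i. \<Sum>v\<in>NC (n - i). ?X (glue u v)) = F i * F (n - i) + (monom 1 1 - 1) *
      ((if l < i then F (i - l) else 0) * (if k < n - i then F (n - i - k) else 0))" .
  qed simp
  also have "\<dots> = (\<Sum>i\<le>n. F i * F (n - i)) + (monom 1 1 - 1) *
      (\<Sum>i\<le>n. (if l < i then F (i - l) else 0) * (if k < n - i then F (n - i - k) else 0))"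
    by (simp only: sum.distrib sum_distrib_left)
  \<comment> \<open>The surviving indices satisfy \<open>l < i\<close> and \<open>k < n - i\<close>.
    With truncated subtraction the new interval is empty when \<open>n\<close> is at most
    \<open>l + k\<close>, as it must be.\<close>
  also have "(\<Sum>i\<le>n. (if l < i then F (i - l) else 0) * (if k < n - i then F (n - i - k) else 0))
     = (\<Sum>i\<in>{l + 1..<l + (n - (l + k))}. F (i - l) * F (n - i - k))"
    by (rule sum.mono_neutral_cong_right) auto
  also have "\<dots> = (\<Sum>i\<in>{1..<n - (l + k)}. F i * F (n - (l + k) - i))"
    by (rule sum.reindex_bij_witness[of _ "\<lambda>i. i + l" "\<lambda>i. i - l"])
       (auto simp: algebra_simps)
  finally show ?thesis .
qed

lemma starts_with_single_one_Cons:
  "starts_with_single_one (1 # r) \<longleftrightarrow> r = [] \<or> hd r \<noteq> 1"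
  by (cases r) (auto simp: starts_with_single_one_def)

theorem mainTheorem6:
  fixes a b a' b' :: nat and \<rho> \<rho>' :: "nat list"
  assumes "a \<ge> 1" "b \<ge> 1" "a' \<ge> 1" "b' \<ge> 1"
    and "a + b = a' + b'"
    and "\<rho> \<in> NC a" "\<rho>' \<in> NC a'"
    and "b \<ge> 2 \<Longrightarrow> starts_with_single_one \<rho>"
    and "b' \<ge> 2 \<Longrightarrow> starts_with_single_one \<rho>'"
  shows "subword_equiv (map (\<lambda>x. x + 1) \<rho> @ replicate b 1) (map (\<lambda>x. x + 1) \<rho>' @ replicate b' 1)"
proof -
  obtain k k' where k: "b = Suc k" "b' = Suc k'"
    using assms(2,4) by (metis One_nat_def Suc_le_D)
  obtain l l' where l: "a = Suc l" "a' = Suc l'"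
    using assms(1,3) by (metis One_nat_def Suc_le_D)
  obtain r where r: "\<rho> = 1 # r"
    using NC_letters(2)[OF assms(6)] assms(6) l by (cases \<rho>) (auto simp: NC_iff)
  obtain r' where r': "\<rho>' = 1 # r'"
    using NC_letters(2)[OF assms(7)] assms(7) l by (cases \<rho>') (auto simp: NC_iff)
  have rec: "occ_poly \<rho> b (Suc n) = (\<Sum>i\<le>n. occ_poly \<rho> b i * occ_poly \<rho> b (n - i)) +
      (monom 1 1 - 1) * (\<Sum>i\<in>{1..<n - (l + k)}. occ_poly \<rho> b i * occ_poly \<rho> b (n - (l + k) - i))" for n
    unfolding r k using assms(6,8) starts_with_single_one_Cons
    by (intro occ_poly_rec) (auto simp: r k l)
  \<comment> \<open>Stated with \<open>l + k\<close> in place of \<open>l' + k'\<close>, so that the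
    two recursions have literally the same shape.\<close>
  have rec': "occ_poly \<rho>' b' (Suc n) = (\<Sum>i\<le>n. occ_poly \<rho>' b' i * occ_poly \<rho>' b' (n - i)) +
      (monom 1 1 - 1) * (\<Sum>i\<in>{1..<n - (l + k)}. occ_poly \<rho>' b' i * occ_poly \<rho>' b' (n - (l + k) - i))" for n
  proof -
    have "l + k = l' + k'" using assms(5) k l by simp
    then show ?thesis
      unfolding r' k using assms(7,9) starts_with_single_one_Cons
      by (simp only:, intro occ_poly_rec) (auto simp: r' k l)
  qed
  \<comment> \<open>Both polynomials are \<open>1\<close> at \<open>0\<close>, and the recursion at
    \<open>m + 1\<close> refers only to arguments up to \<open>m\<close>, hence the strong
    induction.\<close>
  have "occ_poly \<rho> b n = occ_poly \<rho>' b' n" for n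
  proof (induction n rule: less_induct)
    case (less n)
    show ?case
    proof (cases n)
      case 0
      have "pattern \<rho> b \<noteq> []" "pattern \<rho>' b' \<noteq> []" by (simp_all add: pattern_def k)
      then show ?thesis by (simp add: 0 occ_poly_def NC_0 occurrences_Nil)
    next
      case (Suc m)
      then show ?thesis
        unfolding Suc rec rec' using less Suc by (intro arg_cong2[of _ _ _ _ "(+)"] arg_cong2[of _ _ _ _ "(*)"] sum.cong) auto
    qed
  qed
  then have "int (card {w \<in> NC n. occurrences (pattern \<rho> b) w = k}) =
      int (card {w \<in> NC n. occurrences (pattern \<rho>' b') w = k})" for n k
    by (simp only: flip: coeff_occ_poly)
  then show ?thesis
    by (simp add: subword_equiv_def pattern_def)
qed

end
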